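(* Let $E$ be a Banach space and $1\le p\le\infty$. A sequence $(x_n)_n\subset E$ is $p$-null if and only if $(x_n)_n$ is norm convergent to zero and relatively $p$-compact (i.e. the set $\{x_n\colon n\in\mathbb N\}$ is relatively $p$-compact).
   Context: For $1\le p<\infty$, $\ell_p(E)$ is the Banach space of sequences $(x_n)_n$ in $E$ with $\|(x_n)_n\|_p=(\sum_n\|x_n\|^p)^{1/p}<\infty$; for $p=\infty$ the space used in place of $\ell_p(E)$ is $c_0(E)$, the norm-null sequences in $E$ with the supremum norm. $B_X$ denotes the closed unit ball of a Banach space $X$. Let $\frac1p+\frac1{p'}=1$, with the convention that $\ell_{p'}$ means $c_0$ if $p=1$ (and $\ell_{p'}=\ell_1$ if $p=\infty$). For $(x_n)_n\in\ell_p(E)$, its $p$-convex hull is $p\text{-}\mathrm{co}\{x_n\}=\{\sum_{n=1}^\infty\alpha_nx_n\colon(\alpha_n)_n\in B_{\ell_{p'}}\}$. A set $K\subset E$ is relatively $p$-compact if there is $(x_n)_n\in\ell_p(E)$ with $K\subset p\text{-}\mathrm{co}\{x_n\}$. A sequence $(x_n)_n$ in $E$ is $p$-null if, given $\varepsilon>0$, there exist $n_0\in\mathbb N$ and $(z_k)_k\in\varepsilon B_{\ell_p(E)}$ such that $x_n\in p\text{-}\mathrm{co}\{z_k\}$ for all $n\ge n_0$. *)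

theory Defs
  imports "HOL-Analysis.Analysis"
begin

text \<open>
  A Banach space over the real or the complex field. The type class \<^class>\<open>banach\<close> provides
  only the real structure, so the scalar action is a parameter. By the Gelfand--Mazur theorem the
  scalar types admitted here are, up to isomorphism, exactly the reals and the complex numbers.
\<close>

locale banach_space_over = vector_space smul
  for smul :: "'k::{real_normed_field, heine_borel} \<Rightarrow> 'a::banach \<Rightarrow> 'a" +
  assumes norm_smul: "norm (smul c x) = norm c * norm x"
    and smul_of_real: "smul (of_real r) x = r *\<^sub>R x"

lemma banach_space_over_real: "banach_space_over (scaleR :: real \<Rightarrow> 'a::banach \<Rightarrow> 'a)"
  by unfold_locales (simp_all add: algebra_simps)

lemma banach_space_over_complex: "banach_space_over ((*) :: complex \<Rightarrow> complex \<Rightarrow> complex)"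
  by unfold_locales (simp_all add: algebra_simps norm_mult scaleR_conv_of_real)

text \<open>For \<open>p = \<infinity>\<close> the space used in place of \<open>\<ell>\<^sub>p\<close> is \<open>c\<^sub>0\<close>, both for vectors and for scalars.\<close>

definition lp_space :: "ennreal \<Rightarrow> (nat \<Rightarrow> 'a::real_normed_vector) set" where
  "lp_space p =
    (if p = \<infinity> then {x. x \<longlonglongrightarrow> 0} else {x. summable (\<lambda>n. norm (x n) powr enn2real p)})"

definition lp_norm :: "ennreal \<Rightarrow> (nat \<Rightarrow> 'a::real_normed_vector) \<Rightarrow> real" where
  "lp_norm p x =
    (if p = \<infinity> then (SUP n. norm (x n))
     else (\<Sum>n. norm (x n) powr enn2real p) powr (1 / enn2real p))"

definition lp_ball :: "ennreal \<Rightarrow> real \<Rightarrow> (nat \<Rightarrow> 'a::real_normed_vector) set" where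
  "lp_ball p r = {x \<in> lp_space p. lp_norm p x \<le> r}"

text \<open>In \<^typ>\<open>ennreal\<close>, \<open>inverse 0 = \<infinity>\<close> and \<open>inverse \<infinity> = 0\<close>, which covers \<open>p = 1\<close> and \<open>p = \<infinity>\<close>.\<close>

definition conj_exponent :: "ennreal \<Rightarrow> ennreal" where
  "conj_exponent p = inverse (1 - inverse p)"

lemma conj_exponent:
  assumes "1 \<le> p"
  shows "inverse p + inverse (conj_exponent p) = 1"
proof -
  have "inverse p \<le> 1"
    using assms
    by (cases p) (auto simp: inverse_ennreal divide_simps)
  moreover have "inverse (inverse y) = y" for y :: ennreal
  proof (cases y)
    case (real r)
    then show ?thesis
      by (cases "r = 0") (auto simp: inverse_ennreal)
  qed simp
  ultimately show ?thesis
    by (simp add: conj_exponent_def)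
qed

lemma conj_exponent_1: "conj_exponent 1 = \<infinity>"
  by (simp add: conj_exponent_def)

lemma conj_exponent_infinity: "conj_exponent \<infinity> = 1"
  by (simp add: conj_exponent_def)

definition p_convex_hull ::
  "('k::real_normed_field \<Rightarrow> 'a::real_normed_vector \<Rightarrow> 'a) \<Rightarrow> ennreal \<Rightarrow> (nat \<Rightarrow> 'a) \<Rightarrow> 'a set" where
  "p_convex_hull smul p x =
    {y. \<exists>\<alpha> \<in> lp_ball (conj_exponent p) 1. (\<lambda>n. smul (\<alpha> n) (x n)) sums y}"

definition relatively_p_compact ::
  "('k::real_normed_field \<Rightarrow> 'a::real_normed_vector \<Rightarrow> 'a) \<Rightarrow> ennreal \<Rightarrow> 'a set \<Rightarrow> bool" where
  "relatively_p_compact smul p K \<longleftrightarrow> (\<exists>x \<in> lp_space p. K \<subseteq> p_convex_hull smul p x)"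

definition p_null ::
  "('k::real_normed_field \<Rightarrow> 'a::real_normed_vector \<Rightarrow> 'a) \<Rightarrow> ennreal \<Rightarrow> (nat \<Rightarrow> 'a) \<Rightarrow> bool" where
  "p_null smul p x \<longleftrightarrow>
    (\<forall>\<epsilon>>0. \<exists>n\<^sub>0. \<exists>z \<in> lp_ball p \<epsilon>. \<forall>n\<ge>n\<^sub>0. x n \<in> p_convex_hull smul p z)"

end

theory Submission
  imports Defs "HOL-Complex_Analysis.Great_Picard"
begin

text \<open>
  Write \<open>\<Phi>\<^sub>z \<alpha> = \<Sum>n. \<alpha> n \<cdot> z n\<close> for \<open>z\<close> in \<open>\<ell>\<^sub>p\<close> and \<open>\<alpha>\<close> in \<open>\<ell>\<^sub>q\<close>, where \<open>q\<close> is the conjugate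
  exponent; the \<open>p\<close>-convex hull of \<open>z\<close> is the image of the unit ball of \<open>\<ell>\<^sub>q\<close> under \<open>\<Phi>\<^sub>z\<close>, and
  Hoelder's inequality bounds the operator norm of \<open>\<Phi>\<^sub>z\<close> by the norm of \<open>z\<close>. So a \<open>p\<close>-null sequence
  tends to \<open>0\<close>. It is also relatively \<open>p\<close>-compact: its tail lies in the hull of a single \<open>z\<close>, and
  putting the finitely many remaining terms in front of \<open>z\<close> catches them as well.

  For the converse, let \<open>x\<close> tend to \<open>0\<close> with \<open>x n = \<Phi>\<^sub>y (\<alpha> n)\<close> and every \<open>\<alpha> n\<close> in the unit ball. The
  coefficients \<open>\<alpha> n\<close> need not become small, but they may be changed by elements of a kernel.
  Factor \<open>y j = t j \<cdot> w j\<close> with \<open>t\<close> a null sequence and \<open>w\<close> still in \<open>\<ell>\<^sub>p\<close> (\<open>lp_space_factor_null\<close>);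
  then \<open>x n = \<Phi>\<^sub>w (t \<cdot> \<alpha> n)\<close>, and multiplication by \<open>t\<close> is a compact operator on \<open>\<ell>\<^sub>q\<close>. Concretely, if
  along a subsequence the \<open>\<alpha> n\<close> converge coordinatewise to \<open>a\<close>, then \<open>t \<cdot> (\<alpha> n - a)\<close> tends to \<open>0\<close> in the
  norm of \<open>\<ell>\<^sub>q\<close> (\<open>diagonal_operator_convergence\<close>). Hence \<open>\<Phi>\<^sub>w (t \<cdot> a) = lim x n = 0\<close>, so that
  \<open>x n = \<Phi>\<^sub>w (t \<cdot> (\<alpha> n - a))\<close> has arbitrarily small coefficients and lies in the hull of any prescribed
  small multiple of \<open>w\<close> (\<open>subsequence_in_hull\<close>). Since every subsequence has a further one of this
  kind, \<open>x\<close> is \<open>p\<close>-null.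
\<close>

section \<open>Conjugate exponents\<close>

lemma one_le_ennreal_cases:
  assumes "1 \<le> (p::ennreal)"
  obtains (infinite) "p = top" | (finite) s where "p = ennreal s" "1 \<le> s"
  using assms by (cases p) (auto simp: ennreal_le_iff simp flip: ennreal_1)

lemma one_le_conj_exponent: "1 \<le> conj_exponent p"
proof (cases "1 - inverse p")
  case (real r)
  have "1 - inverse p \<le> 1"
    by (simp add: diff_le_self_ennreal)
  then have "r \<le> 1"
    using real by (simp add: ennreal_le_1)
  then show ?thesis
    using real by (cases "r = 0")
      (auto simp: conj_exponent_def inverse_ennreal one_le_inverse simp flip: ennreal_1)
next
  case top
  then show ?thesis
    using diff_le_self_ennreal[of 1 "inverse p"] by simp
qed

lemma conj_exponent_finite:
  assumes p: "p = ennreal s" and s: "1 < s"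
  shows "conj_exponent p = ennreal (s / (s - 1))"
proof -
  have "1 - inverse p = ennreal (1 - inverse s)"
    using s by (simp add: p inverse_ennreal ennreal_minus[symmetric] flip: ennreal_1)
  then have "conj_exponent p = ennreal (inverse (1 - inverse s))"
    using s by (simp add: conj_exponent_def inverse_ennreal field_simps)
  also have "inverse (1 - inverse s) = s / (s - 1)"
    using s by (simp add: field_simps)
  finally show ?thesis .
qed

section \<open>Balls of the sequence spaces\<close>

text \<open>
  A null sequence is bounded, so its supremum is a genuine one and not the default value of an
  unbounded set.
\<close>

lemma lp_ball_top_iff:
  "x \<in> lp_ball top r \<longleftrightarrow> x \<longlonglongrightarrow> 0 \<and> (\<forall>n. norm (x n) \<le> r)"
proof -
  have "(SUP n. norm (x n)) \<le> r \<longleftrightarrow> (\<forall>n. norm (x n) \<le> r)" if x: "x \<longlonglongrightarrow> 0"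
  proof -
    obtain K where "\<And>n. norm (x n) \<le> K"
      using convergent_imp_Bseq[of x] x by (auto simp: Bseq_def convergent_def)
    then have "bdd_above (range (\<lambda>n. norm (x n)))"
      by (auto intro!: bdd_aboveI[of _ K])
    then show ?thesis
      by (subst cSUP_le_iff) auto
  qed
  then show ?thesis
    by (auto simp: lp_ball_def lp_space_def lp_norm_def)
qed

text \<open>The \<open>p\<close>-th root is removed, so that norms are compared by comparing series termwise.\<close>

lemma lp_ball_finite_iff:
  assumes "1 \<le> s" "0 \<le> r"
  shows "x \<in> lp_ball (ennreal s) r \<longleftrightarrow>
    summable (\<lambda>n. norm (x n) powr s) \<and> (\<Sum>n. norm (x n) powr s) \<le> r powr s"
proof -
  have "A powr (1 / s) \<le> r \<longleftrightarrow> A \<le> r powr s" if "0 \<le> A" for A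
  proof
    assume "A powr (1 / s) \<le> r"
    then have "(A powr (1 / s)) powr s \<le> r powr s"
      using assms by (intro powr_mono2) auto
    then show "A \<le> r powr s"
      using assms that by (simp add: powr_powr)
  next
    assume "A \<le> r powr s"
    then have "A powr (1 / s) \<le> (r powr s) powr (1 / s)"
      using assms that by (intro powr_mono2) auto
    then show "A powr (1 / s) \<le> r"
      using assms by (simp add: powr_powr)
  qed
  then show ?thesis
    using assms by (auto simp: lp_ball_def lp_space_def lp_norm_def suminf_nonneg)
qed

lemma lp_norm_nonneg: "0 \<le> lp_norm p x" if "x \<in> lp_space p"
proof (cases "p = top")
  case True
  then have "x \<in> lp_ball top (lp_norm p x)"
    using that by (simp add: lp_ball_def)
  then have "norm (x 0) \<le> lp_norm p x"
    unfolding lp_ball_top_iff by blast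
  then show ?thesis
    using norm_ge_zero order_trans by blast
qed (simp add: lp_norm_def)

lemma lp_ball_radius_nonneg: "x \<in> lp_ball p r \<Longrightarrow> 0 \<le> r"
  using lp_norm_nonneg[of x p] by (auto simp: lp_ball_def)

text \<open>
  Membership in a ball depends on the norms of the terms only. The two sequences may live in
  different spaces; the main use is rescaling, with equality in the hypothesis.
\<close>

lemma lp_ball_dominated:
  assumes p: "1 \<le> p" and x: "x \<in> lp_ball p r" and c: "0 \<le> c"
    and le: "\<And>n. norm (y n) \<le> c * norm (x n)"
  shows "y \<in> lp_ball p (c * r)"
  using p
proof (cases rule: one_le_ennreal_cases)
  case infinite
  then have x0: "x \<longlonglongrightarrow> 0" and xr: "\<And>n. norm (x n) \<le> r"
    using x by (auto simp: lp_ball_top_iff)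
  have "(\<lambda>n. c * norm (x n)) \<longlonglongrightarrow> 0"
    using x0 by (intro tendsto_mult_right_zero tendsto_norm_zero)
  then have "y \<longlonglongrightarrow> 0"
    by (rule Lim_null_comparison[rotated]) (simp add: le)
  moreover have "norm (y n) \<le> c * r" for n
    using le[of n] mult_left_mono[OF xr[of n] c] by linarith
  ultimately show ?thesis
    by (simp add: infinite lp_ball_top_iff)
next
  case (finite s)
  have r: "0 \<le> r"
    using x by (rule lp_ball_radius_nonneg)
  from x have sx: "summable (\<lambda>n. norm (x n) powr s)"
    and bx: "(\<Sum>n. norm (x n) powr s) \<le> r powr s"
    using finite r by (auto simp: lp_ball_finite_iff)
  have le': "norm (y n) powr s \<le> c powr s * norm (x n) powr s" for n
    using powr_mono2[OF _ _ le[of n], of s] finite c by (simp add: powr_mult)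
  have sy: "summable (\<lambda>n. norm (y n) powr s)"
    by (rule summable_comparison_test'[OF summable_mult[OF sx, of "c powr s"], of 0])
      (use le' in auto)
  have "(\<Sum>n. norm (y n) powr s) \<le> (\<Sum>n. c powr s * norm (x n) powr s)"
    by (intro suminf_le le' sy summable_mult sx)
  also have "\<dots> = c powr s * (\<Sum>n. norm (x n) powr s)"
    by (rule suminf_mult[OF sx])
  also have "\<dots> \<le> (c * r) powr s"
    using bx c r by (simp add: powr_mult mult_left_mono)
  finally show ?thesis
    using finite c r sy by (simp add: lp_ball_finite_iff)
qed

lemma lp_ball_coordinate:
  assumes q: "1 \<le> q" and a: "a \<in> lp_ball q r"
  shows "norm (a j) \<le> r"
  using q
proof (cases rule: one_le_ennreal_cases)
  case infinite
  then show ?thesis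
    using a by (simp add: lp_ball_top_iff)
next
  case (finite s)
  have r: "0 \<le> r"
    using a by (rule lp_ball_radius_nonneg)
  with a finite have "summable (\<lambda>n. norm (a n) powr s)" "(\<Sum>n. norm (a n) powr s) \<le> r powr s"
    by (auto simp: lp_ball_finite_iff)
  then have "norm (a j) powr s \<le> r powr s"
    using sum_le_suminf[of "\<lambda>n. norm (a n) powr s" "{j}"] by simp
  then show ?thesis
    using finite r powr_less_mono2[of s r "norm (a j)"] by (auto simp: not_less[symmetric])
qed

text \<open>A strictly positive radius, even for \<open>w = 0\<close>, allows dividing by it.\<close>

lemma lp_ball_exists_pos_radius:
  assumes "w \<in> lp_space p"
  obtains C where "0 < C" "w \<in> lp_ball p C"
proof
  show "0 < lp_norm p w + 1"
    using lp_norm_nonneg[OF assms] by simp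
  show "w \<in> lp_ball p (lp_norm p w + 1)"
    using assms by (simp add: lp_ball_def)
qed

text \<open>
  The next three lemmas serve to enlarge a \<open>p\<close>-convex hull by finitely many points put in front of
  its generators: coefficients of old points are shifted, new points have unit vectors as
  coefficients, and the longer sequence of generators stays in the space.
\<close>

lemma lp_ball_prepend_zeros:
  assumes q: "1 \<le> q" and a: "a \<in> lp_ball q r"
  shows "(\<lambda>k. if k < m then 0 else a (k - m)) \<in> lp_ball q r" (is "?b \<in> _")
proof -
  have r: "0 \<le> r"
    using a by (rule lp_ball_radius_nonneg)
  from q show ?thesis
  proof (cases rule: one_le_ennreal_cases)
    case infinite
    with a have a0: "a \<longlonglongrightarrow> 0" and ar: "\<And>n. norm (a n) \<le> r"
      by (auto simp: lp_ball_top_iff)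
    have "(\<lambda>k. ?b (k + m)) \<longlonglongrightarrow> 0"
      using a0 by simp
    then have "?b \<longlonglongrightarrow> 0"
      by (rule LIMSEQ_offset)
    then show ?thesis
      using ar r by (simp add: infinite lp_ball_top_iff)
  next
    case (finite s)
    with a r have sa: "summable (\<lambda>n. norm (a n) powr s)"
      and ba: "(\<Sum>n. norm (a n) powr s) \<le> r powr s"
      by (auto simp: lp_ball_finite_iff)
    have "(\<lambda>k. norm (?b (k + m)) powr s) sums (\<Sum>n. norm (a n) powr s)"
      using sa by (simp add: summable_sums)
    then have "(\<lambda>k. norm (?b k) powr s) sums (\<Sum>n. norm (a n) powr s)"
      by (subst (asm) sums_iff_shift) simp
    then show ?thesis
      using finite r ba by (auto simp: lp_ball_finite_iff sums_iff)
  qed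
qed

lemma lp_ball_unit_vector:
  assumes q: "1 \<le> q"
  shows "(\<lambda>k. if k = m then 1 else 0 :: 'k::real_normed_field) \<in> lp_ball q 1" (is "?e \<in> _")
  using q
proof (cases rule: one_le_ennreal_cases)
  case infinite
  have "?e \<longlonglongrightarrow> 0"
    by (rule tendsto_eventually) (auto intro!: eventually_sequentiallyI[of "Suc m"])
  then show ?thesis
    by (simp add: infinite lp_ball_top_iff)
next
  case (finite s)
  have "(\<lambda>k. norm (?e k) powr s) = (\<lambda>k. if k = m then 1 else 0)"
    by auto
  then have "(\<lambda>k. norm (?e k) powr s) sums 1"
    using sums_single[of m "\<lambda>_. 1::real"] by simp
  then show ?thesis
    using finite by (auto simp: lp_ball_finite_iff sums_iff)
qed

lemma lp_space_prepend:
  assumes z: "z \<in> lp_space p"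
  shows "(\<lambda>k. if k < m then x k else z (k - m)) \<in> lp_space p" (is "?y \<in> _")
proof (cases "p = top")
  case True
  have "(\<lambda>k. ?y (k + m)) \<longlonglongrightarrow> 0"
    using z True by (simp add: lp_space_def)
  then have "?y \<longlonglongrightarrow> 0"
    by (rule LIMSEQ_offset)
  then show ?thesis
    using True by (simp add: lp_space_def)
next
  case False
  have "summable (\<lambda>k. norm (?y (k + m)) powr enn2real p)"
    using z False by (simp add: lp_space_def)
  then have "summable (\<lambda>k. norm (?y k) powr enn2real p)"
    by (subst (asm) summable_iff_shift)
  then show ?thesis
    using False by (simp add: lp_space_def)
qed

section \<open>Hoelder's inequality\<close>

text \<open>
  In each range of \<open>p\<close> the products are dominated by a series with sum at most \<open>1\<close>: one of the two
  factors if the other is bounded by \<open>1\<close> (\<open>p = 1\<close> or \<open>p = \<infinity>\<close>), and otherwise the convex combination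
  of \<open>q\<close>-th and \<open>p\<close>-th powers from Young's inequality.
\<close>

lemma Hoelder_unit_ball:
  assumes p: "1 \<le> p" and a: "a \<in> lp_ball (conj_exponent p) 1" and b: "b \<in> lp_ball p 1"
  shows "summable (\<lambda>n. norm (a n) * norm (b n))" "(\<Sum>n. norm (a n) * norm (b n)) \<le> 1"
proof -
  have "\<exists>f. (\<forall>n. norm (a n) * norm (b n) \<le> f n) \<and> summable f \<and> suminf f \<le> 1"
    using p
  proof (cases rule: one_le_ennreal_cases)
    case infinite
    then have "a \<in> lp_ball (ennreal 1) 1"
      using a by (simp add: conj_exponent_infinity[simplified])
    then have "summable (\<lambda>n. norm (a n))" "(\<Sum>n. norm (a n)) \<le> 1"
      by (simp_all only: lp_ball_finite_iff order_refl zero_le_one) auto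
    moreover have "\<And>n. norm (b n) \<le> 1"
      using b infinite by (auto simp: lp_ball_top_iff)
    ultimately show ?thesis
      by (intro exI[of _ "\<lambda>n. norm (a n)"]) (auto intro: mult_left_le)
  next
    case (finite s)
    have sb: "summable (\<lambda>n. norm (b n) powr s)" "(\<Sum>n. norm (b n) powr s) \<le> 1"
      using b finite by (auto simp: lp_ball_finite_iff)
    show ?thesis
    proof (cases "s = 1")
      case True
      then have "a \<in> lp_ball top 1"
        using a finite by (simp add: conj_exponent_1)
      then have "\<And>n. norm (a n) \<le> 1"
        by (auto simp: lp_ball_top_iff)
      then show ?thesis
        using sb True by (intro exI[of _ "\<lambda>n. norm (b n)"]) (auto intro: mult_left_le_one_le)
    next
      case False
      define s' where "s' = s / (s - 1)"
      have s: "1 < s" "1 < s'" "1 / s' + 1 / s = 1"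
        using False finite by (auto simp: s'_def field_simps)
      have sa: "summable (\<lambda>n. norm (a n) powr s')" "(\<Sum>n. norm (a n) powr s') \<le> 1"
        using a s conj_exponent_finite[OF finite(1) s(1)]
        by (auto simp: lp_ball_finite_iff s'_def)
      let ?f = "\<lambda>n. norm (a n) powr s' * (1 / s') + norm (b n) powr s * (1 / s)"
      have le: "norm (a n) * norm (b n) \<le> ?f n" for n
        using Youngs_inequality[of s' s "norm (a n)" "norm (b n)"] s by simp
      have sums: "?f sums ((\<Sum>n. norm (a n) powr s') * (1 / s') + (\<Sum>n. norm (b n) powr s) * (1 / s))"
        by (intro sums_add sums_mult2 summable_sums sa sb)
      have "(\<Sum>n. norm (a n) powr s') * (1 / s') + (\<Sum>n. norm (b n) powr s) * (1 / s)
          \<le> 1 * (1 / s') + 1 * (1 / s)"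
        using s sa sb by (intro add_mono mult_right_mono) auto
      then show ?thesis
        using le sums s by (intro exI[of _ ?f]) (auto simp: sums_iff)
    qed
  qed
  then obtain f where le: "\<And>n. norm (a n) * norm (b n) \<le> f n"
    and f: "summable f" "suminf f \<le> 1"
    by blast
  show sm: "summable (\<lambda>n. norm (a n) * norm (b n))"
    by (rule summable_comparison_test'[OF f(1), of 0]) (use le in auto)
  show "(\<Sum>n. norm (a n) * norm (b n)) \<le> 1"
    using suminf_le[OF le sm f(1)] f(2) by simp
qed

lemma Hoelder_lp_ball:
  assumes p: "1 \<le> p" and a: "a \<in> lp_ball (conj_exponent p) r" and b: "b \<in> lp_ball p s"
    and pos: "0 < r" "0 < s"
  shows "summable (\<lambda>n. norm (a n) * norm (b n))" "(\<Sum>n. norm (a n) * norm (b n)) \<le> r * s"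
proof -
  have a': "(\<lambda>n. a n /\<^sub>R r) \<in> lp_ball (conj_exponent p) 1"
    using lp_ball_dominated[OF one_le_conj_exponent a, of "inverse r" "\<lambda>n. a n /\<^sub>R r"] pos by simp
  have b': "(\<lambda>n. b n /\<^sub>R s) \<in> lp_ball p 1"
    using lp_ball_dominated[OF p b, of "inverse s" "\<lambda>n. b n /\<^sub>R s"] pos by simp
  have eq: "norm (a n) * norm (b n) = (r * s) * (norm (a n /\<^sub>R r) * norm (b n /\<^sub>R s))" for n
    using pos by (simp add: field_simps)
  note H = Hoelder_unit_ball[OF p a' b']
  show "summable (\<lambda>n. norm (a n) * norm (b n))"
    unfolding eq by (rule summable_mult[OF H(1)])
  have "(\<Sum>n. norm (a n) * norm (b n)) = (r * s) * (\<Sum>n. norm (a n /\<^sub>R r) * norm (b n /\<^sub>R s))"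
    unfolding eq by (rule suminf_mult[OF H(1)])
  also have "\<dots> \<le> r * s"
    using H(2) pos by (simp add: mult_left_le)
  finally show "(\<Sum>n. norm (a n) * norm (b n)) \<le> r * s" .
qed

section \<open>Splitting off a null factor\<close>

text \<open>
  A convergent series stays convergent after division by a suitable null sequence (du Bois-Reymond,
  Dini). The square roots of the tails \<open>r n = a n + r (Suc n)\<close> work, because
  \<open>a n / sqrt (r n) \<le> 2 * (sqrt (r n) - sqrt (r (Suc n)))\<close> telescopes. Once the tail vanishes, so do
  the terms, and \<open>0 / 0 = 0\<close> does no harm.
\<close>

lemma summable_dini:
  fixes a :: "nat \<Rightarrow> real"
  assumes nn: "\<And>n. 0 \<le> a n" and a: "summable a"
  obtains t where "\<And>n. 0 \<le> t n" "t \<longlonglongrightarrow> 0" "\<And>n. t n = 0 \<Longrightarrow> a n = 0"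
    "summable (\<lambda>n. a n / t n)"
proof
  define r where "r n = (\<Sum>i. a (i + n))" for n
  have sh: "summable (\<lambda>i. a (i + n))" for n
    using a by (simp add: summable_iff_shift)
  have r_nn: "0 \<le> r n" for n
    unfolding r_def by (intro suminf_nonneg sh nn)
  have r_Suc: "r n = a n + r (Suc n)" for n
    using suminf_split_head[OF sh[of n]] by (simp add: r_def)
  have r0: "r \<longlonglongrightarrow> 0"
    unfolding r_def using a by (rule suminf_exist_split2)
  let ?t = "\<lambda>n. sqrt (r n)"
  show "0 \<le> ?t n" for n
    by (simp add: r_nn)
  show t0: "?t \<longlonglongrightarrow> 0"
    using tendsto_real_sqrt[OF r0] by simp
  show "a n = 0" if "?t n = 0" for n
    using that r_Suc[of n] r_nn[of "Suc n"] nn[of n] by simp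
  have le: "a n / ?t n \<le> 2 * (?t n - ?t (Suc n))" for n
  proof (cases "r n = 0")
    case True
    then show ?thesis
      using r_Suc[of n] r_nn[of "Suc n"] nn[of n] by simp
  next
    case False
    then have pos: "0 < ?t n"
      using r_nn[of n] by simp
    have mono: "?t (Suc n) \<le> ?t n"
      using r_Suc[of n] nn[of n] by simp
    have "a n = (?t n + ?t (Suc n)) * (?t n - ?t (Suc n))"
      using r_Suc[of n] r_nn[of n] r_nn[of "Suc n"]
      by (simp add: algebra_simps)
    also have "\<dots> \<le> (2 * ?t n) * (?t n - ?t (Suc n))"
      using mono by (intro mult_right_mono) auto
    finally show ?thesis
      using pos by (simp add: divide_le_eq mult_ac)
  qed
  have "summable (\<lambda>n. 2 * (?t n - ?t (Suc n)))"
    using telescope_sums'[OF t0] by (intro summable_mult) (auto simp: sums_iff)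
  then show "summable (\<lambda>n. a n / ?t n)"
    by (rule summable_comparison_test'[of _ 0]) (use le nn r_nn in auto)
qed

text \<open>
  In \<open>c\<^sub>0\<close> the square root of the norm can be divided out directly. For finite \<open>p\<close> the previous lemma
  is applied to the \<open>p\<close>-th powers of the norms, and the \<open>p\<close>-th root of its null sequence is divided out.
\<close>

lemma lp_space_factor_null:
  assumes p: "1 \<le> p" and y: "y \<in> lp_space p"
  obtains t w where "\<And>j. 0 \<le> t j" "t \<longlonglongrightarrow> 0" "w \<in> lp_space p" "\<And>j. y j = t j *\<^sub>R w j"
  using p
proof (cases rule: one_le_ennreal_cases)
  case infinite
  define t where "t j = sqrt (norm (y j))" for j
  define w where "w j = y j /\<^sub>R t j" for j
  have "(\<lambda>j. norm (y j)) \<longlonglongrightarrow> 0"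
    using y infinite by (auto simp: lp_space_def intro: tendsto_norm_zero)
  then have t0: "t \<longlonglongrightarrow> 0"
    unfolding t_def using tendsto_real_sqrt by fastforce
  have "norm (w j) = t j" for j
    by (simp add: w_def t_def real_div_sqrt inverse_eq_divide)
  then have "w \<longlonglongrightarrow> 0"
    using t0 by (subst tendsto_norm_zero_iff[symmetric]) simp
  then have "w \<in> lp_space p"
    by (simp add: lp_space_def infinite)
  moreover have "y j = t j *\<^sub>R w j" for j
    by (cases "y j = 0") (auto simp: t_def w_def)
  ultimately show thesis
    using t0 by (intro that[of t w]) (auto simp: t_def)
next
  case (finite s)
  let ?a = "\<lambda>j. norm (y j) powr s"
  have "summable ?a"
    using y finite by (simp add: lp_space_def)
  then obtain u where u: "\<And>n. 0 \<le> u n" "u \<longlonglongrightarrow> 0" "\<And>n. u n = 0 \<Longrightarrow> ?a n = 0"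
    "summable (\<lambda>n. ?a n / u n)"
    using summable_dini[of ?a] by auto
  define t where "t j = u j powr (1 / s)" for j
  define w where "w j = y j /\<^sub>R t j" for j
  have t0: "t \<longlonglongrightarrow> 0"
    unfolding t_def using finite
    by (intro tendsto_zero_powrI[OF u(2) tendsto_const]) (auto simp: u)
  have "norm (w j) powr s = ?a j / u j" for j
    using finite u(1)[of j]
    by (simp add: w_def t_def powr_mult powr_powr powr_divide inverse_eq_divide)
  then have w: "w \<in> lp_space p"
    using u(4) finite by (simp add: lp_space_def)
  have "y j = t j *\<^sub>R w j" for j
    using u(3)[of j] by (cases "u j = 0") (auto simp: t_def w_def)
  then show thesis
    using t0 w by (intro that[of t w]) (auto simp: t_def)
qed

section \<open>Compactness of diagonal operators\<close>

text \<open>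
  Multiplication by a null sequence turns coordinatewise convergence in the unit ball into norm
  convergence: finitely many coordinates converge uniformly, and on the remaining ones the small
  factor \<open>t j\<close> beats the uniform bound on the norm of \<open>\<alpha> k - a\<close>. For \<open>q = \<infinity>\<close> the limit \<open>a\<close> is only
  bounded and may fail to be in \<open>c\<^sub>0\<close>, which is why \<open>a\<close> appears only multiplied by \<open>t\<close>.
\<close>

lemma diagonal_operator_convergence:
  fixes \<alpha> :: "nat \<Rightarrow> nat \<Rightarrow> 'b::real_normed_vector"
  assumes q: "1 \<le> q" and \<alpha>: "\<And>k. \<alpha> k \<in> lp_ball q 1" and a: "\<And>j. (\<lambda>k. \<alpha> k j) \<longlonglongrightarrow> a j"
    and t: "\<And>j. 0 \<le> t j" "t \<longlonglongrightarrow> 0" and \<delta>: "0 < \<delta>"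
  shows "\<forall>\<^sub>F k in sequentially. (\<lambda>j. t j *\<^sub>R (\<alpha> k j - a j)) \<in> lp_ball q \<delta>"
  using q
proof (cases rule: one_le_ennreal_cases)
  case infinite
  have \<alpha>1: "norm (\<alpha> k j) \<le> 1" for k j
    using \<alpha>[of k] infinite by (simp add: lp_ball_top_iff)
  have a1: "norm (a j) \<le> 1" for j
    by (rule LIMSEQ_le_const2[OF tendsto_norm[OF a]]) (use \<alpha>1 in auto)
  have d2: "norm (\<alpha> k j - a j) \<le> 2" for k j
    using norm_triangle_ineq4[of "\<alpha> k j" "a j"] \<alpha>1[of k j] a1[of j] by linarith
  have bnd: "norm (t j *\<^sub>R (\<alpha> k j - a j)) \<le> t j * 2" for k j
    using mult_left_mono[OF d2 t(1)] t(1)[of j] by simp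
  have "\<forall>\<^sub>F j in sequentially. t j < \<delta> / 2"
    using t(2) \<delta> by (intro order_tendstoD) auto
  then obtain J where J: "\<And>j. j \<ge> J \<Longrightarrow> t j < \<delta> / 2"
    by (auto simp: eventually_sequentially)
  have "(\<lambda>k. norm (t j *\<^sub>R (\<alpha> k j - a j))) \<longlonglongrightarrow> 0" for j
    by (auto intro!: tendsto_norm_zero tendsto_eq_intros a)
  then have "\<forall>\<^sub>F k in sequentially. norm (t j *\<^sub>R (\<alpha> k j - a j)) < \<delta>" for j
    using \<delta> order_tendstoD(2) by blast
  then have "\<forall>\<^sub>F k in sequentially. \<forall>j\<in>{..<J}. norm (t j *\<^sub>R (\<alpha> k j - a j)) < \<delta>"
    by (intro eventually_ball_finite) auto
  then show ?thesis
  proof eventually_elim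
    case (elim k)
    have "norm (t j *\<^sub>R (\<alpha> k j - a j)) \<le> \<delta>" for j
      using elim bnd[of j k] J[of j] by (cases "j < J") force+
    moreover have "(\<lambda>j. t j * 2) \<longlonglongrightarrow> 0"
      using t(2) by (rule tendsto_mult_left_zero)
    then have "(\<lambda>j. t j *\<^sub>R (\<alpha> k j - a j)) \<longlonglongrightarrow> 0"
      by (rule Lim_null_comparison[rotated]) (use bnd in auto)
    ultimately show ?case
      by (simp add: infinite lp_ball_top_iff)
  qed
next
  case (finite s)
  have s: "0 < s"
    using finite by simp
  have \<alpha>s: "summable (\<lambda>j. norm (\<alpha> k j) powr s)" "(\<Sum>j. norm (\<alpha> k j) powr s) \<le> 1" for k
    using \<alpha>[of k] finite by (auto simp: lp_ball_finite_iff)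
  \<comment> \<open>Fatou's lemma for series: the limit \<open>a\<close> stays in the unit ball.\<close>
  have apart: "(\<Sum>j<N. norm (a j) powr s) \<le> 1" for N
  proof (rule LIMSEQ_le_const2)
    show "(\<lambda>k. \<Sum>j<N. norm (\<alpha> k j) powr s) \<longlonglongrightarrow> (\<Sum>j<N. norm (a j) powr s)"
      using s by (intro tendsto_sum tendsto_powr' tendsto_norm a tendsto_const) auto
    have "(\<Sum>j<N. norm (\<alpha> k j) powr s) \<le> 1" for k
      using sum_le_suminf[OF \<alpha>s(1)[of k], of "{..<N}"] \<alpha>s(2)[of k] by simp
    then show "\<exists>K. \<forall>k\<ge>K. (\<Sum>j<N. norm (\<alpha> k j) powr s) \<le> 1"
      by blast
  qed
  have as: "summable (\<lambda>j. norm (a j) powr s)"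
    by (rule summableI_nonneg_bounded[OF _ apart]) simp
  have as1: "(\<Sum>j. norm (a j) powr s) \<le> 1"
    by (rule suminf_le_const[OF as apart])
  \<comment> \<open>From \<open>norm (u - v) \<le> 2 * max (norm u) (norm v)\<close>: a bound for the \<open>s\<close>-th power of the norm of
    \<open>\<alpha> k - a\<close> that does not depend on \<open>k\<close>.\<close>
  define M where "M = 2 powr s * 2"
  have M: "0 < M"
    by (simp add: M_def)
  define g where "g k j = 2 powr s * (norm (\<alpha> k j) powr s + norm (a j) powr s)" for k j
  have dg: "norm (\<alpha> k j - a j) powr s \<le> g k j" for k j
  proof -
    have "norm (\<alpha> k j - a j) \<le> 2 * max (norm (\<alpha> k j)) (norm (a j))"
      using norm_triangle_ineq4[of "\<alpha> k j" "a j"] by linarith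
    then have "norm (\<alpha> k j - a j) powr s \<le> (2 * max (norm (\<alpha> k j)) (norm (a j))) powr s"
      using s by (intro powr_mono2) auto
    also have "\<dots> = 2 powr s * max (norm (\<alpha> k j)) (norm (a j)) powr s"
      by (simp add: powr_mult)
    also have "\<dots> \<le> g k j"
      unfolding g_def by (intro mult_left_mono) (auto simp: max_def)
    finally show ?thesis .
  qed
  have g: "summable (g k)" "suminf (g k) \<le> M" for k
  proof -
    have "g k sums (2 powr s * ((\<Sum>j. norm (\<alpha> k j) powr s) + (\<Sum>j. norm (a j) powr s)))"
      unfolding g_def by (intro sums_mult sums_add summable_sums \<alpha>s as)
    moreover have "2 powr s * ((\<Sum>j. norm (\<alpha> k j) powr s) + (\<Sum>j. norm (a j) powr s)) \<le> M"
      unfolding M_def using \<alpha>s(2)[of k] as1 by (intro mult_left_mono) auto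
    ultimately show "summable (g k)" "suminf (g k) \<le> M"
      by (auto simp: sums_iff)
  qed
  \<comment> \<open>Chosen so that the coordinates from \<open>J\<close> on contribute at most half of \<open>\<delta> powr s\<close>.\<close>
  define \<eta> where "\<eta> = \<delta> powr s / 2 / M"
  have \<eta>: "0 < \<eta>" "\<eta> * M = \<delta> powr s / 2"
    using M \<delta> by (auto simp: \<eta>_def)
  define f where "f k j = norm (t j *\<^sub>R (\<alpha> k j - a j)) powr s" for k j
  have f_eq: "f k j = t j powr s * norm (\<alpha> k j - a j) powr s" for k j
    using t(1)[of j] by (simp add: f_def powr_mult)
  have "(\<lambda>j. t j powr s) \<longlonglongrightarrow> 0"
    using s t by (intro tendsto_zero_powrI[OF t(2) tendsto_const]) auto
  then have "\<forall>\<^sub>F j in sequentially. t j powr s < \<eta>"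
    using \<eta> by (intro order_tendstoD) auto
  then obtain J where J: "\<And>j. j \<ge> J \<Longrightarrow> t j powr s < \<eta>"
    by (auto simp: eventually_sequentially)
  have fle: "f k j \<le> (if j \<in> {..<J} then f k j else 0) + \<eta> * g k j" for k j
  proof (cases "j < J")
    case True
    have "0 \<le> \<eta> * g k j"
      using \<eta> by (simp add: g_def)
    then show ?thesis
      using True by simp
  next
    case False
    have "f k j \<le> \<eta> * g k j"
      unfolding f_eq using False J[of j] dg \<eta> by (intro mult_mono) auto
    then show ?thesis
      using False by simp
  qed
  have dom: "(\<lambda>j. (if j \<in> {..<J} then f k j else 0) + \<eta> * g k j)
      sums ((\<Sum>j<J. f k j) + \<eta> * suminf (g k))" for k
    by (intro sums_add sums_mult summable_sums g sums_If_finite_set) simp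
  have "(\<lambda>k. \<Sum>j<J. f k j) \<longlonglongrightarrow> (\<Sum>j<J. 0)"
  proof (intro tendsto_sum)
    fix j
    have "(\<lambda>k. norm (t j *\<^sub>R (\<alpha> k j - a j))) \<longlonglongrightarrow> 0"
      by (auto intro!: tendsto_norm_zero tendsto_eq_intros a)
    then show "(\<lambda>k. f k j) \<longlonglongrightarrow> 0"
      unfolding f_def using s by (intro tendsto_zero_powrI[OF _ tendsto_const]) auto
  qed
  then have "\<forall>\<^sub>F k in sequentially. (\<Sum>j<J. f k j) < \<delta> powr s / 2"
    using \<delta> by (intro order_tendstoD) auto
  then show ?thesis
  proof eventually_elim
    case (elim k)
    have sf: "summable (f k)"
      by (rule summable_comparison_test'[OF sums_summable[OF dom[of k]], of 0])
        (use fle[of k] in \<open>auto simp: f_def\<close>)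
    have "suminf (f k) \<le> (\<Sum>j<J. f k j) + \<eta> * suminf (g k)"
      using suminf_le[OF fle sf sums_summable[OF dom]] sums_unique[OF dom[of k]] by simp
    also have "\<dots> \<le> \<delta> powr s / 2 + \<eta> * M"
      using elim g(2)[of k] \<eta> by (intro add_mono mult_left_mono) auto
    also have "\<dots> = \<delta> powr s"
      using \<eta> by simp
    finally show ?case
      using sf finite \<delta> by (simp add: lp_ball_finite_iff f_def[abs_def] del: norm_scaleR)
  qed
qed

section \<open>Null sequences in the \<open>p\<close>-sense\<close>

lemma p_convex_hullI:
  assumes "\<alpha> \<in> lp_ball (conj_exponent p) 1" "(\<lambda>n. smul (\<alpha> n) (x n)) sums y"
  shows "y \<in> p_convex_hull smul p x"
  using assms by (auto simp: p_convex_hull_def)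

context banach_space_over
begin

lemma Hoelder_series:
  assumes p: "1 \<le> p" and a: "a \<in> lp_ball (conj_exponent p) r" and w: "w \<in> lp_ball p s"
    and pos: "0 < r" "0 < s"
  shows "summable (\<lambda>n. smul (a n) (w n))" "norm (\<Sum>n. smul (a n) (w n)) \<le> r * s"
proof -
  note H = Hoelder_lp_ball[OF p a w pos]
  have sn: "summable (\<lambda>n. norm (smul (a n) (w n)))"
    using H(1) by (simp add: norm_smul)
  show "summable (\<lambda>n. smul (a n) (w n))"
    using sn by (rule summable_norm_cancel)
  show "norm (\<Sum>n. smul (a n) (w n)) \<le> r * s"
    using summable_norm[OF sn] H(2) by (simp add: norm_smul)
qed

lemma smul_scaleR_left: "smul (r *\<^sub>R c) x = smul c (r *\<^sub>R x)"
  by (metis mult.commute scaleR_conv_of_real scale_scale smul_of_real)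

lemma p_null_imp_tendsto:
  assumes p: "1 \<le> p" and x: "p_null smul p x"
  shows "x \<longlonglongrightarrow> 0"
proof (rule LIMSEQ_I)
  fix e :: real
  assume "0 < e"
  then have e: "0 < e / 2"
    by simp
  with x obtain m z where z: "z \<in> lp_ball p (e / 2)"
    and m: "\<And>n. n \<ge> m \<Longrightarrow> x n \<in> p_convex_hull smul p z"
    unfolding p_null_def by blast
  have "norm (x n) < e" if n: "n \<ge> m" for n
  proof -
    obtain a where a: "a \<in> lp_ball (conj_exponent p) 1" "(\<lambda>k. smul (a k) (z k)) sums x n"
      using m[OF n] by (auto simp: p_convex_hull_def)
    then have "norm (x n) \<le> e / 2"
      using Hoelder_series(2)[OF p a(1) z _ e] by (simp add: sums_iff)
    then show ?thesis
      using e by simp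
  qed
  then show "\<exists>m. \<forall>n\<ge>m. norm (x n - 0) < e"
    by auto
qed

text \<open>The definition of \<open>p\<close>-null at radius \<open>1\<close> already covers all but finitely many terms.\<close>

lemma p_null_imp_relatively_p_compact:
  assumes p: "1 \<le> p" and x: "p_null smul p x"
  shows "relatively_p_compact smul p (range x)"
proof -
  obtain m z where z: "z \<in> lp_ball p 1"
    and m: "\<And>n. n \<ge> m \<Longrightarrow> x n \<in> p_convex_hull smul p z"
    using x unfolding p_null_def by (meson zero_less_one)
  let ?y = "\<lambda>k. if k < m then x k else z (k - m)"
  have y: "?y \<in> lp_space p"
    using z by (intro lp_space_prepend) (simp add: lp_ball_def)
  have "x n \<in> p_convex_hull smul p ?y" for n
  proof (cases "n < m")
    case True
    let ?e = "\<lambda>k. if k = n then 1 else 0 :: 'k"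
    have "(\<lambda>k. smul (?e k) (?y k)) = (\<lambda>k. if k = n then x k else 0)"
      using True by auto
    then have "(\<lambda>k. smul (?e k) (?y k)) sums x n"
      using sums_single[of n x] by simp
    then show ?thesis
      by (rule p_convex_hullI[OF lp_ball_unit_vector[OF one_le_conj_exponent]])
  next
    case False
    then have "x n \<in> p_convex_hull smul p z"
      by (intro m) simp
    then obtain a where a: "a \<in> lp_ball (conj_exponent p) 1" "(\<lambda>k. smul (a k) (z k)) sums x n"
      by (auto simp: p_convex_hull_def)
    let ?b = "\<lambda>k. if k < m then 0 else a (k - m)"
    have "(\<lambda>k. smul (?b (k + m)) (?y (k + m))) sums x n"
      using a(2) by simp
    then have "(\<lambda>k. smul (?b k) (?y k)) sums x n"
      by (subst (asm) sums_iff_shift) simp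
    then show ?thesis
      by (rule p_convex_hullI[OF lp_ball_prepend_zeros[OF one_le_conj_exponent a(1)]])
  qed
  then show ?thesis
    using y unfolding relatively_p_compact_def by blast
qed

end

text \<open>
  Here \<open>L\<close> is the value at \<open>t \<cdot> a\<close> of the operator with generators \<open>w\<close>. Since \<open>t \<cdot> (\<alpha> k - a)\<close> tends to
  \<open>0\<close> in norm, \<open>x\<close> converges to \<open>L\<close>; hence \<open>L = 0\<close>, and subtracting \<open>t \<cdot> a\<close> from the coefficients
  makes them small without changing \<open>x k\<close>.
\<close>

lemma subsequence_in_hull:
  fixes smul :: "'k::{real_normed_field, heine_borel} \<Rightarrow> 'a::banach \<Rightarrow> 'a"
  assumes "banach_space_over smul" and p: "1 \<le> p" and x: "x \<longlonglongrightarrow> 0"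
    and \<alpha>: "\<And>k. \<alpha> k \<in> lp_ball (conj_exponent p) 1"
    and lim: "\<And>j. (\<lambda>k. \<alpha> k j) \<longlonglongrightarrow> a j"
    and t: "\<And>j. 0 \<le> t j" "t \<longlonglongrightarrow> 0"
    and w: "w \<in> lp_ball p C" "0 < C"
    and sums: "\<And>k. (\<lambda>j. smul (\<alpha> k j) (t j *\<^sub>R w j)) sums x k"
    and c: "0 < c"
  shows "\<forall>\<^sub>F k in sequentially. x k \<in> p_convex_hull smul p (\<lambda>j. c *\<^sub>R w j)"
proof -
  interpret banach_space_over smul by fact
  define v where "v k j = t j *\<^sub>R (\<alpha> k j - a j)" for k j
  have small: "\<forall>\<^sub>F k in sequentially. v k \<in> lp_ball (conj_exponent p) \<delta>" if "0 < \<delta>" for \<delta>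
    unfolding v_def
    by (rule diagonal_operator_convergence[OF one_le_conj_exponent \<alpha> lim t that])
  define L where "L = (\<Sum>j. smul (t j *\<^sub>R a j) (w j))"
  have v_series: "(\<lambda>j. smul (v k j) (w j)) sums (x k - L) \<and> norm (x k - L) \<le> \<delta> * C"
    if v: "v k \<in> lp_ball (conj_exponent p) \<delta>" and \<delta>: "0 < \<delta>" for k \<delta>
  proof -
    note H = Hoelder_series[OF p v w(1) \<delta> w(2)]
    have vs: "(\<lambda>j. smul (v k j) (w j)) sums (\<Sum>j. smul (v k j) (w j))"
      using H(1) by (rule summable_sums)
    have "smul (t j *\<^sub>R a j) (w j) = smul (\<alpha> k j) (t j *\<^sub>R w j) - smul (v k j) (w j)" for j
      by (simp add: v_def smul_scaleR_left scale_left_diff_distrib)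
    then have "(\<lambda>j. smul (t j *\<^sub>R a j) (w j)) sums (x k - (\<Sum>j. smul (v k j) (w j)))"
      using sums_diff[OF sums[of k] vs] by simp
    then have "L = x k - (\<Sum>j. smul (v k j) (w j))"
      by (simp add: L_def sums_iff)
    then show ?thesis
      using vs H(2) by simp
  qed
  have "x \<longlonglongrightarrow> L"
  proof (rule tendstoI)
    fix e :: real
    assume e: "0 < e"
    then have \<delta>: "0 < e / (2 * C)"
      using w by simp
    show "\<forall>\<^sub>F k in sequentially. dist (x k) L < e"
      using small[OF \<delta>]
    proof eventually_elim
      case (elim k)
      have "norm (x k - L) \<le> e / 2"
        using v_series[OF elim \<delta>] w by simp
      then show ?case
        using e by (simp add: dist_norm)
    qed
  qed
  then have L: "L = 0"
    using x by (rule LIMSEQ_unique)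
  show ?thesis
    using small[OF c]
  proof eventually_elim
    case (elim k)
    have "(\<lambda>j. v k j /\<^sub>R c) \<in> lp_ball (conj_exponent p) 1"
      using lp_ball_dominated[OF one_le_conj_exponent elim, of "inverse c" "\<lambda>j. v k j /\<^sub>R c"] c
      by simp
    moreover have "(\<lambda>j. smul (v k j /\<^sub>R c) (c *\<^sub>R w j)) sums x k"
      using v_series[OF elim c] L c by (simp add: smul_scaleR_left)
    ultimately show ?case
      by (rule p_convex_hullI)
  qed
qed

text \<open>
  If a tail condition failed for the fixed generators \<open>c \<cdot> w\<close>, it would fail along a subsequence.
  The scalar field is locally compact, so a diagonal argument makes the coefficients converge
  coordinatewise along a further subsequence, which contradicts the previous lemma.
\<close>

lemma tendsto_and_relatively_p_compact_imp_p_null: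
  fixes smul :: "'k::{real_normed_field, heine_borel} \<Rightarrow> 'a::banach \<Rightarrow> 'a"
  assumes E: "banach_space_over smul" and p: "1 \<le> p" and x: "x \<longlonglongrightarrow> 0"
    and K: "relatively_p_compact smul p (range x)"
  shows "p_null smul p x"
  unfolding p_null_def
proof (intro allI impI)
  fix \<epsilon> :: real
  assume \<epsilon>: "0 < \<epsilon>"
  obtain y where y: "y \<in> lp_space p" "range x \<subseteq> p_convex_hull smul p y"
    using K by (auto simp: relatively_p_compact_def)
  obtain t w where t: "\<And>j. 0 \<le> t j" "t \<longlonglongrightarrow> 0" and w: "w \<in> lp_space p"
    and y_eq: "\<And>j. y j = t j *\<^sub>R w j"
    using lp_space_factor_null[OF p y(1)] by blast
  obtain C where C: "0 < C" "w \<in> lp_ball p C"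
    using lp_ball_exists_pos_radius[OF w] by blast
  have "\<forall>n. \<exists>\<alpha>. \<alpha> \<in> lp_ball (conj_exponent p) 1 \<and> (\<lambda>j. smul (\<alpha> j) (y j)) sums x n"
    using y(2) by (auto simp: p_convex_hull_def)
  then obtain \<alpha> where \<alpha>: "\<And>n. \<alpha> n \<in> lp_ball (conj_exponent p) 1"
    "\<And>n. (\<lambda>j. smul (\<alpha> n j) (t j *\<^sub>R w j)) sums x n"
    unfolding y_eq by metis
  \<comment> \<open>The scaling that moves \<open>w\<close> into the ball of radius \<open>\<epsilon>\<close>.\<close>
  define c where "c = \<epsilon> / C"
  have c: "0 < c"
    using \<epsilon> C by (simp add: c_def)
  have c_eq: "c * C = \<epsilon>"
    using C by (simp add: c_def)
  let ?z = "\<lambda>j. c *\<^sub>R w j"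
  have z: "?z \<in> lp_ball p \<epsilon>"
    using lp_ball_dominated[OF p C(2), of c ?z] c C c_eq by simp
  have \<alpha>1: "norm (\<alpha> n j) \<le> 1" for n j
  proof -
    have "\<alpha> n \<in> lp_ball (conj_exponent p) 1"
      by (rule \<alpha>)
    with one_le_conj_exponent[of p] show ?thesis
      by (rule lp_ball_coordinate)
  qed
  have "\<forall>\<^sub>F n in sequentially. x n \<in> p_convex_hull smul p ?z"
  proof (rule ccontr)
    assume "\<not> (\<forall>\<^sub>F n in sequentially. x n \<in> p_convex_hull smul p ?z)"
    then obtain \<sigma> where \<sigma>: "strict_mono (\<sigma> :: nat \<Rightarrow> nat)"
      "\<And>n. x (\<sigma> n) \<notin> p_convex_hull smul p ?z"
      using not_eventually_sequentiallyD by blast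
    obtain \<kappa> where \<kappa>: "strict_mono (\<kappa> :: nat \<Rightarrow> nat)"
      "\<And>j. \<exists>l. (\<lambda>k. \<alpha> (\<sigma> (\<kappa> k)) j) \<longlonglongrightarrow> l"
      using function_convergent_subsequence[of UNIV "\<lambda>n. \<alpha> (\<sigma> n)" 1] \<alpha>1 by auto
    then obtain a where a: "\<And>j. (\<lambda>k. \<alpha> (\<sigma> (\<kappa> k)) j) \<longlonglongrightarrow> a j"
      by metis
    have "strict_mono (\<sigma> \<circ> \<kappa>)"
      using \<sigma>(1) \<kappa>(1) by (rule strict_mono_o)
    then have "(\<lambda>k. x (\<sigma> (\<kappa> k))) \<longlonglongrightarrow> 0"
      using LIMSEQ_subseq_LIMSEQ[OF x] by (simp add: o_def)
    then have "\<forall>\<^sub>F k in sequentially. x (\<sigma> (\<kappa> k)) \<in> p_convex_hull smul p ?z"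
      by (rule subsequence_in_hull[OF E p _ \<alpha>(1) a t C(2,1) \<alpha>(2) c])
    then show False
      using \<sigma>(2) by simp
  qed
  then show "\<exists>m. \<exists>z\<in>lp_ball p \<epsilon>. \<forall>n\<ge>m. x n \<in> p_convex_hull smul p z"
    using z by (auto simp: eventually_sequentially)
qed

theorem corollary1p4:
  fixes smul :: "'k::{real_normed_field, heine_borel} \<Rightarrow> 'a::banach \<Rightarrow> 'a"
    and p :: ennreal
    and x :: "nat \<Rightarrow> 'a"
  assumes "banach_space_over smul"
    and "1 \<le> p"
  shows "p_null smul p x \<longleftrightarrow> x \<longlonglongrightarrow> 0 \<and> relatively_p_compact smul p (range x)"
proof -
  interpret banach_space_over smul by fact
  show ?thesis
    using p_null_imp_tendsto p_null_imp_relatively_p_compact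
      tendsto_and_relatively_p_compact_imp_p_null assms by blast
qed

end
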